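(* The graph $K_6-e$ (the complete graph on $6$ vertices with one edge removed) is not an induced subgraph of $\mathcal{B}_k(G)$ for any finite simple graph $G$ and any positive integer $k$. Hence, for every $n\ge 6$, the graph $K_n-e$ is not an induced subgraph of any Bell coloring graph.
   Context: All graphs are finite and simple. A stable $k$-partition of a graph $G$ is a multiset $P=\{V_1,\dots,V_k\}$ of $k$ independent sets of $G$ (some possibly empty) that partition $V(G)$. For $v\in V(G)$, $P-v$ denotes the multiset $\{V_i\setminus\{v\}:1\le i\le k\}$. The Bell $k$-coloring graph $\mathcal{B}_k(G)$ has as vertices all stable $k$-partitions of $G$, and two distinct partitions $P,Q$ are adjacent if and only if $P-v=Q-v$ for some $v\in V(G)$. A Bell coloring graph is any graph of the form $\mathcal{B}_k(G)$. *)

theory Defs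
  imports
    "HOL-Library.Multiset"
    "Graph_Theory.Graph_Theory"
begin

text \<open>
  A finite simple graph is a \<^locale>\<open>pair_graph\<close>: an irreflexive, symmetric arc relation on a
  finite vertex set, each edge being represented by its two opposite arcs.
\<close>

definition independent_set :: "'a pair_pre_digraph \<Rightarrow> 'a set \<Rightarrow> bool" where
  "independent_set G S \<longleftrightarrow>
    S \<subseteq> pverts G \<and> (\<forall>u\<in>S. \<forall>v\<in>S. (u, v) \<notin> parcs G)"

text \<open>
  Disjointness is required between positions of the enumeration \<open>Vs\<close>, not between
  distinct members, so only the empty set can have multiplicity greater than one.
\<close>

definition stable_partitions :: "nat \<Rightarrow> 'a pair_pre_digraph \<Rightarrow> 'a set multiset set" where
  "stable_partitions k G =
    {P. \<exists>Vs. P = mset Vs \<and> length Vs = k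
      \<and> (\<forall>i<k. independent_set G (Vs ! i))
      \<and> (\<forall>i<k. \<forall>j<k. i \<noteq> j \<longrightarrow> Vs ! i \<inter> Vs ! j = {})
      \<and> (\<Union>i<k. Vs ! i) = pverts G}"

definition partition_del :: "'a set multiset \<Rightarrow> 'a \<Rightarrow> 'a set multiset" where
  "partition_del P v = image_mset (\<lambda>S. S - {v}) P"

definition bell_graph :: "nat \<Rightarrow> 'a pair_pre_digraph \<Rightarrow> 'a set multiset pair_pre_digraph" where
  "bell_graph k G =
    \<lparr> pverts = stable_partitions k G,
      parcs = {(P, Q). P \<in> stable_partitions k G \<and> Q \<in> stable_partitions k G \<and> P \<noteq> Q
        \<and> (\<exists>v \<in> pverts G. partition_del P v = partition_del Q v)} \<rparr>"

definition bell_coloring_graph :: "'a set multiset pair_pre_digraph \<Rightarrow> bool" where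
  "bell_coloring_graph B \<longleftrightarrow> (\<exists>G k. pair_graph G \<and> 1 \<le> k \<and> B = bell_graph k G)"

definition complete_graph :: "nat \<Rightarrow> nat pair_pre_digraph" where
  "complete_graph n = \<lparr> pverts = {..<n}, parcs = {(i, j). i < n \<and> j < n \<and> i \<noteq> j} \<rparr>"

definition delete_edge :: "'a pair_pre_digraph \<Rightarrow> 'a \<Rightarrow> 'a \<Rightarrow> 'a pair_pre_digraph" where
  "delete_edge G u v = \<lparr> pverts = pverts G, parcs = parcs G - {(u, v), (v, u)} \<rparr>"

text \<open>All choices of the deleted edge give isomorphic graphs; meaningful for \<open>n \<ge> 2\<close>.\<close>

definition complete_minus_edge :: "nat \<Rightarrow> nat pair_pre_digraph" where
  "complete_minus_edge n = delete_edge (complete_graph n) 0 1"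

text \<open>``Is an induced subgraph of'' up to isomorphism, as usual in graph theory.\<close>

definition is_induced_subgraph_of :: "'a pair_pre_digraph \<Rightarrow> 'b pair_pre_digraph \<Rightarrow> bool" where
  "is_induced_subgraph_of H G \<longleftrightarrow>
    (\<exists>H'. induced_subgraph H' (with_proj G) \<and> digraph_iso (with_proj H) H')"

lemma complete_graph_complete: "complete_digraph n (with_proj (complete_graph n))"
  unfolding complete_digraph_pair_def by (simp add: complete_graph_def)

lemma pair_graph_complete_minus_edge: "pair_graph (complete_minus_edge n)"
proof -
  have "finite {(i, j). i < n \<and> j < n \<and> i \<noteq> j}"
    by (rule finite_subset[of _ "{..<n} \<times> {..<n}"]) auto
  then show ?thesis
    by unfold_locales
      (auto simp: complete_minus_edge_def delete_edge_def complete_graph_def symmetric_def sym_def)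
qed

lemma finite_stable_partitions:
  assumes "finite (pverts G)"
  shows "finite (stable_partitions k G)"
proof (rule finite_subset)
  show "stable_partitions k G \<subseteq> mset ` {Vs. set Vs \<subseteq> Pow (pverts G) \<and> length Vs = k}"
  proof
    fix P assume "P \<in> stable_partitions k G"
    then obtain Vs where Vs: "P = mset Vs" "length Vs = k" "\<forall>i<k. independent_set G (Vs ! i)"
      unfolding stable_partitions_def by blast
    then have "set Vs \<subseteq> Pow (pverts G)"
      by (auto simp: independent_set_def set_conv_nth)
    with Vs show "P \<in> mset ` {Vs. set Vs \<subseteq> Pow (pverts G) \<and> length Vs = k}"
      by blast
  qed
  show "finite (mset ` {Vs. set Vs \<subseteq> Pow (pverts G) \<and> length Vs = k})"
    using assms by (intro finite_imageI finite_lists_length_eq) simp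
qed

lemma pair_graph_bell_graph:
  assumes "pair_graph G"
  shows "pair_graph (bell_graph k G)"
proof -
  interpret G: pair_graph G by fact
  have fin: "finite (stable_partitions k G)"
    by (rule finite_stable_partitions) (rule G.pair_finite_verts)
  have sub: "parcs (bell_graph k G) \<subseteq> stable_partitions k G \<times> stable_partitions k G"
    by (auto simp: bell_graph_def)
  have "finite (parcs (bell_graph k G))"
    by (rule finite_subset[OF sub]) (simp add: fin)
  moreover have "sym (parcs (bell_graph k G))"
    unfolding sym_def bell_graph_def by (simp, metis)
  moreover have "fst e \<noteq> snd e" if "e \<in> parcs (bell_graph k G)" for e
    using that by (auto simp: bell_graph_def)
  moreover have "pverts (bell_graph k G) = stable_partitions k G"
    by (simp add: bell_graph_def)
  ultimately show ?thesis
    using fin sub by unfold_locales (auto simp: symmetric_def)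
qed

end

theory Submission
  imports Defs
begin

text \<open>
  A stable \<open>k\<close>-partition is determined by the set of pairs contained in a common block, that is, by
  the edges of a disjoint union of cliques. Two partitions are adjacent iff these edge sets differ
  and all edges of the symmetric difference share a vertex \<open>v\<close>, a label of the adjacency.
  Two labels leave a single edge to differ in; as three sets cannot differ pairwise in exactly one
  element, at most one label is common to a clique on three or more partitions. If a triangle
  has no common label, then it and all its common neighbours differ only inside three vertices, where
  there are five cluster graphs, the empty and the complete one being not adjacent; so such a
  triangle lies in no 5-clique, and a 5-clique therefore has a common label.
  The two 5-cliques of \<open>K\<^sub>6 - e\<close> meet in four vertices, so they have the same common label, and
  the ends of \<open>e\<close> would be adjacent.
\<close>

section \<open>Induced subgraphs\<close>

lemma is_induced_subgraph_ofE:
  assumes "is_induced_subgraph_of H G"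
  obtains f where "inj_on f (pverts H)" "f ` pverts H \<subseteq> pverts G"
    "\<And>x y. x \<in> pverts H \<Longrightarrow> y \<in> pverts H \<Longrightarrow> (f x, f y) \<in> parcs G \<longleftrightarrow> (x, y) \<in> parcs H"
proof -
  obtain h where iso: "pre_digraph.digraph_isomorphism (with_proj H) h"
    and ind: "induced_subgraph (app_iso h (with_proj H)) (with_proj G)"
    using assms unfolding is_induced_subgraph_of_def digraph_iso_def by blast
  let ?f = "iso_verts h"
  have inj: "inj_on ?f (pverts H)" and "wf_digraph (with_proj H)"
    using iso by (auto simp: pre_digraph.digraph_isomorphism_def)
  then have arc_ends: "x \<in> pverts H" "y \<in> pverts H" if "(x, y) \<in> parcs H" for x y
    using that wf_digraph.wellformed[of "with_proj H" "(x, y)"] by auto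
  have sub: "?f ` pverts H \<subseteq> pverts G" and proj: "snd = iso_head h" "fst = iso_tail h"
    using ind by (simp_all add: induced_subgraph_def subgraph_def compatible_def)
  have arcs: "iso_arcs h ` parcs H = {e \<in> parcs G. fst e \<in> ?f ` pverts H \<and> snd e \<in> ?f ` pverts H}"
    using ind by (simp add: induced_subgraph_def)
  have iso_arc: "iso_arcs h (x, y) = (?f x, ?f y)" if "(x, y) \<in> parcs H" for x y
    using iso that proj by (auto simp: pre_digraph.digraph_isomorphism_def prod_eq_iff)
  have "(?f x, ?f y) \<in> parcs G \<longleftrightarrow> (x, y) \<in> parcs H" if "x \<in> pverts H" "y \<in> pverts H" for x y
  proof
    assume "(?f x, ?f y) \<in> parcs G"
    then have "(?f x, ?f y) \<in> iso_arcs h ` parcs H"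
      using arcs that by auto
    then obtain x' y' where arc: "(x', y') \<in> parcs H" and "?f x = ?f x'" "?f y = ?f y'"
      using iso_arc by auto
    then have "x = x'" "y = y'"
      using inj that arc_ends[OF arc] by (auto dest: inj_onD)
    with arc show "(x, y) \<in> parcs H"
      by simp
  next
    assume "(x, y) \<in> parcs H"
    then have "(?f x, ?f y) \<in> iso_arcs h ` parcs H"
      using iso_arc by (metis imageI)
    then show "(?f x, ?f y) \<in> parcs G"
      using arcs by simp
  qed
  with inj sub show thesis
    by (rule that)
qed

lemma complete_minus_edge_simps:
  "pverts (complete_minus_edge n) = {..<n}"
  "(i, j) \<in> parcs (complete_minus_edge n) \<longleftrightarrow> i < n \<and> j < n \<and> i \<noteq> j \<and> {i, j} \<noteq> {0, 1}"
  by (auto simp: complete_minus_edge_def delete_edge_def complete_graph_def doubleton_eq_iff)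

section \<open>Edge sets differing in a star\<close>

definition edge_set :: "'a set set \<Rightarrow> bool" where
  "edge_set E \<longleftrightarrow> (\<forall>e\<in>E. card e = 2)"

definition agree_off :: "'a \<Rightarrow> 'a set set \<Rightarrow> 'a set set \<Rightarrow> bool" where
  "agree_off v E F \<longleftrightarrow> (\<forall>e\<in>sym_diff E F. v \<in> e)"

definition nearly_equal :: "'a set set \<Rightarrow> 'a set set \<Rightarrow> bool" where
  "nearly_equal E F \<longleftrightarrow> (\<exists>v. agree_off v E F)"

lemma agree_off_refl: "agree_off v E E"
  by (simp add: agree_off_def)

lemma agree_off_sym: "agree_off v E F \<Longrightarrow> agree_off v F E"
  unfolding agree_off_def by blast

lemma agree_off_trans: "agree_off v E F \<Longrightarrow> agree_off v F H \<Longrightarrow> agree_off v E H"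
  unfolding agree_off_def by blast

lemma nearly_equal_refl: "nearly_equal E E"
  by (simp add: nearly_equal_def agree_off_refl)

lemma doubleton_eqI:
  assumes "card e = 2" "u \<in> e" "w \<in> e" "u \<noteq> w"
  shows "e = {u, w}"
  using assms by (auto simp: card_2_iff)

lemma edge_set_sym_diff:
  assumes "edge_set E" "edge_set F" "e \<in> sym_diff E F"
  shows "card e = 2"
  using assms unfolding edge_set_def by blast

lemma sym_diff_eq_doubleton_if_two_labels:
  assumes edges: "edge_set E" "edge_set F" and "E \<noteq> F"
    and labels: "agree_off u E F" "agree_off w E F" "u \<noteq> w"
  shows "sym_diff E F = {{u, w}}"
proof -
  have "e = {u, w}" if "e \<in> sym_diff E F" for e
    using labels that edge_set_sym_diff[OF edges that]
    unfolding agree_off_def by (intro doubleton_eqI) blast+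
  moreover have "sym_diff E F \<noteq> {}"
    using \<open>E \<noteq> F\<close> by blast
  ultimately show ?thesis
    by blast
qed

lemma sym_diff_not_all_singletons:
  assumes "sym_diff E F = {a}" "sym_diff F H = {b}"
  shows "sym_diff E H \<noteq> {c}"
proof
  assume "sym_diff E H = {c}"
  moreover have "sym_diff E H = sym_diff {a} {b}"
    using assms by blast
  ultimately show False
    by (cases "a = b") auto
qed

lemma unique_label_pair:
  assumes edges: "\<And>E. E \<in> S \<Longrightarrow> edge_set E" and "3 \<le> card S"
  shows "\<exists>E\<in>S. \<exists>F\<in>S. \<forall>u w. agree_off u E F \<longrightarrow> agree_off w E F \<longrightarrow> u = w"
proof (rule ccontr)
  assume no_pair: "\<not> ?thesis"
  obtain T where "T \<subseteq> S" "card T = 3"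
    using \<open>3 \<le> card S\<close> by (metis obtain_subset_with_card_n)
  then obtain E F H where EFH: "E \<in> S" "F \<in> S" "H \<in> S" "E \<noteq> F" "F \<noteq> H" "E \<noteq> H"
    by (auto simp: card_3_iff)
  have "\<exists>e. sym_diff A B = {e}" if AB: "A \<in> S" "B \<in> S" "A \<noteq> B" for A B
  proof -
    obtain u w where "agree_off u A B" "agree_off w A B" "u \<noteq> w"
      using no_pair AB by blast
    then have "sym_diff A B = {{u, w}}"
      using edges AB by (intro sym_diff_eq_doubleton_if_two_labels)
    then show ?thesis
      by (rule exI)
  qed
  then show False
    using EFH sym_diff_not_all_singletons[of E F _ H] by metis
qed

lemma common_label_unique:
  assumes "\<And>E. E \<in> S \<Longrightarrow> edge_set E" "3 \<le> card S"
    and "\<And>E F. E \<in> S \<Longrightarrow> F \<in> S \<Longrightarrow> agree_off u E F"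
    and "\<And>E F. E \<in> S \<Longrightarrow> F \<in> S \<Longrightarrow> agree_off w E F"
  shows "u = w"
  using unique_label_pair[OF assms(1,2)] assms(3,4) by blast

section \<open>Triangles without a common label\<close>

definition common_label_triangle :: "'a set set \<Rightarrow> 'a set set \<Rightarrow> 'a set set \<Rightarrow> bool" where
  "common_label_triangle E F H \<longleftrightarrow> (\<exists>v. agree_off v E F \<and> agree_off v F H)"

lemma no_common_label_triangle_support:
  assumes edges: "edge_set E" "edge_set F" "edge_set H"
    and labels: "agree_off u E F" "agree_off w F H" "agree_off x E H"
    and no_common: "\<not> common_label_triangle E F H"
  shows "distinct [u, w, x]" "sym_diff E F \<union> sym_diff F H \<subseteq> Pow {u, w, x}"
proof -
  have not_both: "\<not> (agree_off v E F \<and> agree_off v F H)" for v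
    using no_common unfolding common_label_triangle_def by blast
  have "u \<noteq> w"
    using not_both labels(1,2) by blast
  moreover have "u \<noteq> x"
    using not_both[of u] labels(1,3) agree_off_trans[OF agree_off_sym[OF labels(1)]] by blast
  moreover have "w \<noteq> x"
    using not_both[of w] labels(2,3) agree_off_trans[OF _ agree_off_sym[OF labels(2)]] by blast
  ultimately show distinct: "distinct [u, w, x]"
    by simp
  show "sym_diff E F \<union> sym_diff F H \<subseteq> Pow {u, w, x}"
  proof
    fix e assume e: "e \<in> sym_diff E F \<union> sym_diff F H"
    then have "card e = 2"
      using edge_set_sym_diff edges by blast
    moreover have "u \<in> e \<and> w \<in> e \<or> u \<in> e \<and> x \<in> e \<or> w \<in> e \<and> x \<in> e"
      using e labels unfolding agree_off_def by blast
    ultimately show "e \<in> Pow {u, w, x}"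
      using distinct doubleton_eqI by fastforce
  qed
qed

text \<open>
  An edge \<open>e\<close> in which \<open>L\<close> differed from all of \<open>E\<close>, \<open>F\<close>, \<open>H\<close> would contain all three labels
  towards \<open>L\<close>, so it would meet every edge in which \<open>E\<close>, \<open>F\<close>, \<open>H\<close> differ; if \<open>e\<close> had an
  end outside \<open>T\<close>, its other end would be a common label.
\<close>

lemma common_neighbour_support:
  assumes edges: "edge_set E" "edge_set L"
    and near: "nearly_equal L E" "nearly_equal L F" "nearly_equal L H"
    and no_common: "\<not> common_label_triangle E F H"
    and support: "sym_diff E F \<union> sym_diff F H \<subseteq> Pow T"
  shows "sym_diff L E \<subseteq> Pow T"
proof (rule ccontr)
  assume "\<not> sym_diff L E \<subseteq> Pow T"
  then obtain e y where e: "e \<in> sym_diff L E" and y: "y \<in> e" "y \<notin> T"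
    by blast
  have "card e = 2"
    using edge_set_sym_diff edges e by blast
  then obtain z where z: "e = {y, z}"
    using y(1) by (auto simp: card_2_iff)
  have "e \<notin> sym_diff E F \<union> sym_diff F H"
    using support y by blast
  then have "e \<in> sym_diff L F" "e \<in> sym_diff L H"
    using e by blast+
  then obtain a b c where labels_in_e: "a \<in> e" "b \<in> e" "c \<in> e"
    and labels: "agree_off a L E" "agree_off b L F" "agree_off c L H"
    using near e unfolding nearly_equal_def agree_off_def by metis
  have meet: "f \<inter> e \<noteq> {}" if "f \<in> sym_diff E F \<union> sym_diff F H" for f
  proof -
    have "f \<in> sym_diff L E \<or> f \<in> sym_diff L F \<or> f \<in> sym_diff L H"
      using that by blast
    then have "a \<in> f \<or> b \<in> f \<or> c \<in> f"
      using labels unfolding agree_off_def by metis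
    then show ?thesis
      using labels_in_e by blast
  qed
  have "z \<in> f" if "f \<in> sym_diff E F \<union> sym_diff F H" for f
    using meet[OF that] support that y(2) z by blast
  then have "agree_off z E F \<and> agree_off z F H"
    unfolding agree_off_def by blast
  then show False
    using no_common unfolding common_label_triangle_def by blast
qed

section \<open>Cliques of cluster graphs\<close>

definition cluster_graph :: "'a set set \<Rightarrow> bool" where
  "cluster_graph E \<longleftrightarrow> edge_set E \<and> (\<forall>x y z. {x, y} \<in> E \<longrightarrow> {y, z} \<in> E \<longrightarrow> x \<noteq> z \<longrightarrow> {x, z} \<in> E)"

lemma cluster_graph_edge_set: "cluster_graph E \<Longrightarrow> edge_set E"
  by (simp add: cluster_graph_def)

lemma cluster_graph_trans:
  assumes "cluster_graph E" "{x, y} \<in> E" "{y, z} \<in> E" "x \<noteq> z"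
  shows "{x, z} \<in> E"
  using assms unfolding cluster_graph_def by blast

definition triple_pattern :: "'a \<Rightarrow> 'a \<Rightarrow> 'a \<Rightarrow> 'a set set \<Rightarrow> bool \<times> bool \<times> bool" where
  "triple_pattern u w x E = ({u, w} \<in> E, {u, x} \<in> E, {w, x} \<in> E)"

definition cluster_patterns :: "(bool \<times> bool \<times> bool) set" where
  "cluster_patterns = {(False, False, False), (True, False, False), (False, True, False),
    (False, False, True), (True, True, True)}"

lemma triple_pattern_in_cluster_patterns:
  assumes "cluster_graph E" "distinct [u, w, x]"
  shows "triple_pattern u w x E \<in> cluster_patterns"
proof -
  note trans = cluster_graph_trans[OF assms(1)]
  show ?thesis
    using trans[of w u x] trans[of u w x] trans[of u x w] assms(2)
    unfolding triple_pattern_def cluster_patterns_def by (auto simp: insert_commute)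
qed

lemma eq_if_triple_pattern_eq:
  assumes edges: "edge_set E" "edge_set F" and within: "sym_diff E F \<subseteq> Pow {u, w, x}"
    and pattern: "triple_pattern u w x E = triple_pattern u w x F"
  shows "E = F"
proof (rule ccontr)
  assume "E \<noteq> F"
  then obtain e where e: "e \<in> sym_diff E F"
    by blast
  have "card e = 2" "e \<subseteq> {u, w, x}"
    using edge_set_sym_diff[OF edges e] within e by blast+
  then have "e \<in> {{u, w}, {u, x}, {w, x}}"
    by (auto simp: card_2_iff)
  then show False
    using e pattern unfolding triple_pattern_def by auto
qed

lemma not_nearly_equal_empty_complete_pattern:
  assumes "distinct [u, w, x]" "triple_pattern u w x E = (False, False, False)"
    and "triple_pattern u w x F = (True, True, True)"
  shows "\<not> nearly_equal E F"
proof
  assume "nearly_equal E F"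
  then obtain v where v: "agree_off v E F"
    unfolding nearly_equal_def by blast
  have "{{u, w}, {u, x}, {w, x}} \<subseteq> sym_diff E F"
    using assms(2,3) unfolding triple_pattern_def by simp
  then have "\<forall>e\<in>{{u, w}, {u, x}, {w, x}}. v \<in> e"
    using v unfolding agree_off_def by (meson subsetD)
  then show False
    using assms(1) by auto
qed

lemma card_clique_within_triple:
  assumes cluster: "\<And>E. E \<in> K \<Longrightarrow> cluster_graph E"
    and clique: "pairwise nearly_equal K"
    and "distinct [u, w, x]"
    and within: "\<And>E F. E \<in> K \<Longrightarrow> F \<in> K \<Longrightarrow> sym_diff E F \<subseteq> Pow {u, w, x}"
  shows "card K \<le> 4"
proof (rule ccontr)
  assume "\<not> card K \<le> 4"
  let ?pattern = "triple_pattern u w x"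
  have "inj_on ?pattern K"
    using within by (intro inj_onI eq_if_triple_pattern_eq)
      (simp_all add: cluster cluster_graph_edge_set)
  moreover have "?pattern ` K \<subseteq> cluster_patterns"
    using cluster \<open>distinct [u, w, x]\<close>
    by (intro image_subsetI triple_pattern_in_cluster_patterns)
  moreover have "card cluster_patterns = 5" "finite cluster_patterns"
    by (simp_all add: cluster_patterns_def)
  ultimately have "?pattern ` K = cluster_patterns"
    using \<open>\<not> card K \<le> 4\<close> by (intro card_seteq) (simp_all add: card_image)
  then have "(False, False, False) \<in> ?pattern ` K" "(True, True, True) \<in> ?pattern ` K"
    by (simp_all add: cluster_patterns_def)
  then obtain E F where EF: "E \<in> K" "F \<in> K"
    and patterns: "?pattern E = (False, False, False)" "?pattern F = (True, True, True)"
    by (elim imageE) simp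
  have "E \<noteq> F"
    using patterns by auto
  then have "nearly_equal E F"
    by (rule pairwiseD(1)[OF clique EF])
  then show False
    using not_nearly_equal_empty_complete_pattern[OF \<open>distinct [u, w, x]\<close> patterns] by blast
qed

lemma five_clique_common_label_triangle:
  assumes cluster: "\<And>E. E \<in> K \<Longrightarrow> cluster_graph E" and "5 \<le> card K"
    and clique: "pairwise nearly_equal K" and EFH: "E \<in> K" "F \<in> K" "H \<in> K"
  shows "common_label_triangle E F H"
proof (rule ccontr)
  assume no_common: "\<not> common_label_triangle E F H"
  have near: "nearly_equal A B" if "A \<in> K" "B \<in> K" for A B
    using clique that nearly_equal_refl by (metis pairwiseD(1))
  obtain u w x where labels: "agree_off u E F" "agree_off w F H" "agree_off x E H"
    using near EFH unfolding nearly_equal_def by metis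
  note edges = cluster[THEN cluster_graph_edge_set]
  note triangle = no_common_label_triangle_support[OF EFH[THEN edges] labels no_common]
  have "sym_diff A E \<subseteq> Pow {u, w, x}" if "A \<in> K" for A
    using near that EFH edges no_common triangle(2) by (intro common_neighbour_support) auto
  then have "sym_diff A B \<subseteq> Pow {u, w, x}" if "A \<in> K" "B \<in> K" for A B
    using that by blast
  then have "card K \<le> 4"
    using card_clique_within_triple[OF cluster clique triangle(1)] by blast
  with \<open>5 \<le> card K\<close> show False
    by simp
qed

lemma five_clique_common_label:
  assumes cluster: "\<And>E. E \<in> K \<Longrightarrow> cluster_graph E" and "5 \<le> card K"
    and clique: "pairwise nearly_equal K"
  obtains v where "\<And>E F. E \<in> K \<Longrightarrow> F \<in> K \<Longrightarrow> agree_off v E F"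
proof -
  have triangle: "common_label_triangle E F H" if "E \<in> K" "F \<in> K" "H \<in> K" for E F H
    using five_clique_common_label_triangle[OF cluster \<open>5 \<le> card K\<close> clique] that by blast
  have "3 \<le> card K"
    using \<open>5 \<le> card K\<close> by simp
  then obtain E F where EF: "E \<in> K" "F \<in> K"
    and unique: "\<And>v w. agree_off v E F \<Longrightarrow> agree_off w E F \<Longrightarrow> v = w"
    using unique_label_pair[of K] cluster[THEN cluster_graph_edge_set] by blast
  obtain v where v: "agree_off v E F"
    using triangle[OF EF EF(1)] unfolding common_label_triangle_def by blast
  have "agree_off v F H" if "H \<in> K" for H
    using triangle[OF EF that] unique[OF v] unfolding common_label_triangle_def by blast
  then have "agree_off v A B" if "A \<in> K" "B \<in> K" for A B
    using that agree_off_sym agree_off_trans by metis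
  then show thesis
    by (rule that)
qed

lemma nearly_equal_if_four_common_neighbours:
  assumes cluster: "\<And>A. A \<in> insert E (insert F S) \<Longrightarrow> cluster_graph A"
    and "4 \<le> card S" "E \<notin> S" "F \<notin> S"
    and cliques: "pairwise nearly_equal (insert E S)" "pairwise nearly_equal (insert F S)"
  shows "nearly_equal E F"
proof -
  have "finite S"
    using \<open>4 \<le> card S\<close> by (intro card_ge_0_finite) simp
  then have card: "5 \<le> card (insert E S)" "5 \<le> card (insert F S)"
    using assms(2-4) by simp_all
  obtain u where u: "\<And>A B. A \<in> insert E S \<Longrightarrow> B \<in> insert E S \<Longrightarrow> agree_off u A B"
    using five_clique_common_label[OF _ card(1) cliques(1)] cluster by blast
  obtain w where w: "\<And>A B. A \<in> insert F S \<Longrightarrow> B \<in> insert F S \<Longrightarrow> agree_off w A B"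
    using five_clique_common_label[OF _ card(2) cliques(2)] cluster by blast
  have "edge_set A" if "A \<in> S" for A
    using cluster that by (intro cluster_graph_edge_set) simp
  then have "u = w"
    using u w \<open>4 \<le> card S\<close> by (intro common_label_unique[of S]) simp_all
  obtain A where "A \<in> S"
    using \<open>4 \<le> card S\<close> by fastforce
  then have "agree_off u E A" "agree_off u A F"
    using u w \<open>u = w\<close> by blast+
  then show ?thesis
    unfolding nearly_equal_def by (blast intro: agree_off_trans)
qed

section \<open>Stable partitions as cluster graphs\<close>

definition mset_partition_on :: "'a set \<Rightarrow> 'a set multiset \<Rightarrow> bool" where
  "mset_partition_on U P \<longleftrightarrow> (\<forall>x. size {#S \<in># P. x \<in> S#} = of_bool (x \<in> U))"

definition block_pairs :: "'a set multiset \<Rightarrow> 'a set set" where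
  "block_pairs P = {e. card e = 2 \<and> (\<exists>S\<in>#P. e \<subseteq> S)}"

lemma mset_partition_on_filter_eq:
  assumes "mset_partition_on U P"
  shows "{#S \<in># P. x \<in> S#} = (if x \<in> U then {#insert x {y. {x, y} \<in> block_pairs P}#} else {#})"
proof (cases "x \<in> U")
  case True
  then have "size {#S \<in># P. x \<in> S#} = 1"
    using assms unfolding mset_partition_on_def by simp
  then obtain B where B: "{#S \<in># P. x \<in> S#} = {#B#}"
    using size_1_singleton_mset by blast
  have block_iff: "S \<in># P \<and> x \<in> S \<longleftrightarrow> S = B" for S
    using arg_cong[OF B, of "\<lambda>M. S \<in># M"] by simp
  then have "y \<in> B \<longleftrightarrow> y = x \<or> {x, y} \<in> block_pairs P" for y
    unfolding block_pairs_def by (auto simp: card_2_iff)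
  then have "B = insert x {y. {x, y} \<in> block_pairs P}"
    by blast
  with B True show ?thesis
    by simp
next
  case False
  then have "size {#S \<in># P. x \<in> S#} = 0"
    using assms unfolding mset_partition_on_def by simp
  then show ?thesis
    using False by (simp only: size_eq_0_iff_empty if_False)
qed

lemma mset_partition_on_blockD:
  assumes "mset_partition_on U P" "S \<in># P" "x \<in> S"
  shows "x \<in> U" "S = insert x {y. {x, y} \<in> block_pairs P}"
proof -
  have "S \<in># {#S \<in># P. x \<in> S#}"
    using assms(2,3) by simp
  then show "x \<in> U" "S = insert x {y. {x, y} \<in> block_pairs P}"
    unfolding mset_partition_on_filter_eq[OF assms(1)] by (simp_all split: if_splits)
qed

lemma cluster_graph_block_pairs:
  assumes "mset_partition_on U P"
  shows "cluster_graph (block_pairs P)"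
proof -
  have "{x, z} \<in> block_pairs P"
    if pairs: "{x, y} \<in> block_pairs P" "{y, z} \<in> block_pairs P" and "x \<noteq> z" for x y z
  proof -
    obtain S T where S: "S \<in># P" "x \<in> S" "y \<in> S" and T: "T \<in># P" "y \<in> T" "z \<in> T"
      using pairs unfolding block_pairs_def by auto
    have "S = T"
      using mset_partition_on_blockD(2)[OF assms S(1,3)] mset_partition_on_blockD(2)[OF assms T(1,2)]
      by (rule trans[OF _ sym])
    then show ?thesis
      using S T \<open>x \<noteq> z\<close> unfolding block_pairs_def by auto
  qed
  moreover have "edge_set (block_pairs P)"
    by (simp add: edge_set_def block_pairs_def)
  ultimately show ?thesis
    unfolding cluster_graph_def by blast
qed

lemma size_eq_size_nonempty_plus_count_empty:
  "size P = size {#S \<in># P. S \<noteq> {}#} + count P {}"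
proof -
  have "size P = size ({#S \<in># P. S \<noteq> {}#} + {#S \<in># P. \<not> S \<noteq> {}#})"
    by (rule arg_cong[OF multiset_partition])
  then show ?thesis
    by (simp add: filter_eq_replicate_mset)
qed

lemma mset_partition_on_eqI:
  assumes part: "mset_partition_on U P" "mset_partition_on U Q"
    and "size P = size Q" and pairs: "block_pairs P = block_pairs Q"
  shows "P = Q"
proof -
  have count_nonempty: "count P S = count Q S" if "S \<noteq> {}" for S
  proof -
    obtain x where "x \<in> S"
      using \<open>S \<noteq> {}\<close> by blast
    have "{#T \<in># P. x \<in> T#} = {#T \<in># Q. x \<in> T#}"
      unfolding part[THEN mset_partition_on_filter_eq] pairs ..
    then have "count {#T \<in># P. x \<in> T#} S = count {#T \<in># Q. x \<in> T#} S"
      by simp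
    with \<open>x \<in> S\<close> show ?thesis
      by simp
  qed
  then have "{#S \<in># P. S \<noteq> {}#} = {#S \<in># Q. S \<noteq> {}#}"
    by (intro multiset_eqI) simp
  then have "count P {} = count Q {}"
    using \<open>size P = size Q\<close> size_eq_size_nonempty_plus_count_empty by (metis add_left_cancel)
  with count_nonempty show ?thesis
    by (metis multiset_eqI)
qed

lemma mset_partition_on_partition_del:
  assumes "mset_partition_on U P"
  shows "mset_partition_on (U - {v}) (partition_del P v)"
  unfolding mset_partition_on_def
proof
  fix x
  have "{#S \<in># partition_del P v. x \<in> S#} =
      image_mset (\<lambda>S. S - {v}) {#S \<in># P. x \<in> S \<and> x \<noteq> v#}"
    unfolding partition_del_def filter_mset_image_mset by (simp add: o_def)
  then show "size {#S \<in># partition_del P v. x \<in> S#} = of_bool (x \<in> U - {v})"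
    using assms unfolding mset_partition_on_def by (cases "x = v") auto
qed

lemma partition_del_notin:
  assumes "mset_partition_on U P" "v \<notin> U"
  shows "partition_del P v = P"
proof -
  have "S - {v} = S" if "S \<in># P" for S
    using mset_partition_on_blockD(1)[OF assms(1) that] \<open>v \<notin> U\<close> by blast
  then show ?thesis
    unfolding partition_del_def by (simp cong: image_mset_cong)
qed

lemma block_pairs_partition_del: "block_pairs (partition_del P v) = {e \<in> block_pairs P. v \<notin> e}"
  unfolding block_pairs_def partition_del_def by auto

lemma partition_del_eq_iff_agree_off:
  assumes "mset_partition_on U P" "mset_partition_on U Q" "size P = size Q"
  shows "partition_del P v = partition_del Q v \<longleftrightarrow> agree_off v (block_pairs P) (block_pairs Q)"
proof -
  have "size (partition_del P v) = size (partition_del Q v)"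
    using assms(3) by (simp add: partition_del_def)
  then have "partition_del P v = partition_del Q v \<longleftrightarrow>
      block_pairs (partition_del P v) = block_pairs (partition_del Q v)"
    using assms(1,2) mset_partition_on_partition_del mset_partition_on_eqI by metis
  also have "\<dots> \<longleftrightarrow> agree_off v (block_pairs P) (block_pairs Q)"
    unfolding block_pairs_partition_del agree_off_def by blast
  finally show ?thesis .
qed

lemma stable_partitions_mset_partition_on:
  assumes "P \<in> stable_partitions k G"
  shows "mset_partition_on (pverts G) P" "size P = k"
proof -
  obtain Vs where P: "P = mset Vs" and k: "length Vs = k"
    and disjoint: "\<forall>i<k. \<forall>j<k. i \<noteq> j \<longrightarrow> Vs ! i \<inter> Vs ! j = {}"
    and cover: "(\<Union>i<k. Vs ! i) = pverts G"
    using assms unfolding stable_partitions_def by blast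
  show "size P = k"
    by (simp add: P k)
  have "size {#S \<in># P. x \<in> S#} = of_bool (x \<in> pverts G)" for x
  proof -
    have "size {#S \<in># P. x \<in> S#} = length (filter (\<lambda>S. x \<in> S) Vs)"
      unfolding P by (metis mset_filter size_mset)
    also have "\<dots> = card {i. i < k \<and> x \<in> Vs ! i}"
      by (simp add: length_filter_conv_card k)
    also have "\<dots> = of_bool (x \<in> pverts G)"
    proof (cases "x \<in> pverts G")
      case True
      then obtain i where "i < k" "x \<in> Vs ! i"
        using cover by blast
      then have "{i. i < k \<and> x \<in> Vs ! i} = {i}"
        using disjoint by blast
      then show ?thesis
        using True by simp
    next
      case False
      then have "{i. i < k \<and> x \<in> Vs ! i} = {}"
        using cover by blast
      then show ?thesis
        using False by simp
    qed
    finally show ?thesis .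
  qed
  then show "mset_partition_on (pverts G) P"
    unfolding mset_partition_on_def by blast
qed

lemma inj_on_block_pairs: "inj_on block_pairs (stable_partitions k G)"
  by (intro inj_onI) (metis mset_partition_on_eqI stable_partitions_mset_partition_on)

section \<open>Bell coloring graphs\<close>

lemma bell_graph_arc_iff:
  assumes P: "P \<in> stable_partitions k G" and Q: "Q \<in> stable_partitions k G"
  shows "(P, Q) \<in> parcs (bell_graph k G) \<longleftrightarrow>
    P \<noteq> Q \<and> nearly_equal (block_pairs P) (block_pairs Q)"
proof -
  note part = P[THEN stable_partitions_mset_partition_on(1)]
    Q[THEN stable_partitions_mset_partition_on(1)]
  have "size P = size Q"
    using P Q stable_partitions_mset_partition_on(2) by metis
  note del_eq_iff = partition_del_eq_iff_agree_off[OF part this]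
  have "v \<in> pverts G" if "P \<noteq> Q" "partition_del P v = partition_del Q v" for v
    using that partition_del_notin[OF part(1)] partition_del_notin[OF part(2)] by metis
  then show ?thesis
    using P Q del_eq_iff unfolding bell_graph_def nearly_equal_def by auto
qed

lemma bell_graph_arc_if_four_common_neighbours:
  assumes PQ: "P \<in> stable_partitions k G" "Q \<in> stable_partitions k G" "P \<noteq> Q"
    and S: "S \<subseteq> stable_partitions k G" "4 \<le> card S" "P \<notin> S" "Q \<notin> S"
    and cliques: "pairwise (\<lambda>R R'. (R, R') \<in> parcs (bell_graph k G)) (insert P S)"
      "pairwise (\<lambda>R R'. (R, R') \<in> parcs (bell_graph k G)) (insert Q S)"
  shows "(P, Q) \<in> parcs (bell_graph k G)"
proof -
  have inj: "inj_on block_pairs (insert P (insert Q S))"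
    using inj_on_block_pairs by (rule inj_on_subset) (use PQ S in blast)
  have near: "pairwise nearly_equal (block_pairs ` A)"
    if "pairwise (\<lambda>R R'. (R, R') \<in> parcs (bell_graph k G)) A" "A \<subseteq> stable_partitions k G" for A
    using that bell_graph_arc_iff by (intro pairwise_imageI) (blast dest: pairwiseD)
  have "nearly_equal (block_pairs P) (block_pairs Q)"
  proof (rule nearly_equal_if_four_common_neighbours)
    show "cluster_graph E"
      if "E \<in> insert (block_pairs P) (insert (block_pairs Q) (block_pairs ` S))" for E
      using that PQ S(1) stable_partitions_mset_partition_on(1) cluster_graph_block_pairs by blast
    show "4 \<le> card (block_pairs ` S)"
      using inj S(2) by (subst card_image) (auto intro: inj_on_subset)
    show "block_pairs P \<notin> block_pairs ` S" "block_pairs Q \<notin> block_pairs ` S"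
      using inj S(3,4) by (auto simp: inj_on_def)
    show "pairwise nearly_equal (insert (block_pairs P) (block_pairs ` S))"
      "pairwise nearly_equal (insert (block_pairs Q) (block_pairs ` S))"
      using near[OF cliques(1)] near[OF cliques(2)] PQ S(1) by simp_all
  qed
  then show ?thesis
    using bell_graph_arc_iff PQ by blast
qed

lemma complete_minus_edge_not_induced:
  assumes "6 \<le> n"
  shows "\<not> is_induced_subgraph_of (complete_minus_edge n) (bell_graph k G)"
proof
  assume "is_induced_subgraph_of (complete_minus_edge n) (bell_graph k G)"
  then obtain f where inj: "inj_on f {..<n}" and sub: "f ` {..<n} \<subseteq> stable_partitions k G"
    and arc: "\<And>i j. i < n \<Longrightarrow> j < n \<Longrightarrow>
      (f i, f j) \<in> parcs (bell_graph k G) \<longleftrightarrow> i \<noteq> j \<and> {i, j} \<noteq> {0, 1}"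
    by (rule is_induced_subgraph_ofE) (simp add: complete_minus_edge_simps bell_graph_def)
  let ?S = "f ` {2..<6}"
  have inj6: "inj_on f {..<6}"
    using inj by (rule inj_on_subset) (use assms in auto)
  have clique: "pairwise (\<lambda>P Q. (P, Q) \<in> parcs (bell_graph k G)) (insert (f i) ?S)" if "i < 2" for i
    unfolding image_insert[symmetric] using assms that
    by (intro pairwise_imageI) (auto simp: arc doubleton_eq_iff)
  have "(f 0, f 1) \<in> parcs (bell_graph k G)"
  proof (rule bell_graph_arc_if_four_common_neighbours)
    show "f 0 \<in> stable_partitions k G" "f 1 \<in> stable_partitions k G" "?S \<subseteq> stable_partitions k G"
      using sub assms by auto
    show "f 0 \<noteq> f 1" "f 0 \<notin> ?S" "f 1 \<notin> ?S"
      using inj6 by (auto dest: inj_onD)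
    show "4 \<le> card ?S"
      using inj_on_subset[OF inj6, of "{2..<6}"] by (simp add: card_image subset_iff)
  qed (use clique in simp_all)
  then show False
    using arc[of 0 1] assms by simp
qed

theorem theorem3p10:
  shows "(\<forall>(G :: 'a pair_pre_digraph) k. pair_graph G \<longrightarrow> 1 \<le> k \<longrightarrow>
            \<not> is_induced_subgraph_of (complete_minus_edge 6) (bell_graph k G))
       \<and> (\<forall>n\<ge>6. \<forall>B :: 'a set multiset pair_pre_digraph. bell_coloring_graph B \<longrightarrow>
            \<not> is_induced_subgraph_of (complete_minus_edge n) B)"
  using complete_minus_edge_not_induced unfolding bell_coloring_graph_def by blast

end
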